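(* Let $f:\mathbb{E}\to\mathbb{R}$ be differentiable and satisfy, for constants $\mu,L>0$ and all $x,y\in\mathbb{E}$, $\langle\nabla f(x)-\nabla f(y),x-y\rangle\ge\mu\|x-y\|^2$ and $\|\nabla f(x)-\nabla f(y)\|_*\le L\|x-y\|$. Let $f^*=\min f$ and $\kappa=L/\mu$. Let $(x_k,H_k,d_k,h_k)_{k\ge0}$ be generated by the BFGS method (see context) from $x_0\in\mathbb{E}$ and a positive definite $H_0:\mathbb{E}^*\to\mathbb{E}$, and suppose that for some constant $\eta>0$ the step sizes are such that, for every $k\ge0$, $$f(x_k)-f(x_{k+1})\ge\eta\,\frac{\langle\nabla f(x_k),d_k\rangle^2}{L\|d_k\|^2}.$$ Let $\psi_0:=\psi(LB,H_0^{-1})$ and $K_0^G:=\lceil2\psi_0\rceil$. Then, for all integers $k\ge K_0^G$, $$f(x_k)-f^*\le(1-\eta\kappa^{-2})^k\,[f(x_0)-f^*].$$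
   Context: $\mathbb{E}$ is a real vector space of finite dimension $n\ge1$, $\mathbb{E}^*$ its dual, $\langle s,x\rangle$ the value of $s\in\mathbb{E}^*$ at $x\in\mathbb{E}$. $B:\mathbb{E}\to\mathbb{E}^*$ is a fixed self-adjoint positive definite operator; $\|u\|=\langle Bu,u\rangle^{1/2}$, $\|s\|_*=\langle s,B^{-1}s\rangle^{1/2}$. For self-adjoint positive definite $X,Y:\mathbb{E}\to\mathbb{E}^*$, $\psi(X,Y):=\operatorname{Tr}(X^{-1}(Y-X))-\ln\det(X^{-1}Y)\ (\ge0)$. BFGS method: given $x_0$ and self-adjoint positive definite $H_0:\mathbb{E}^*\to\mathbb{E}$, for $k\ge0$: $d_k=H_k\nabla f(x_k)$; choose a step size $h_k>0$; $x_{k+1}=x_k-h_kd_k$; $\delta_k=x_{k+1}-x_k$, $\gamma_k=\nabla f(x_{k+1})-\nabla f(x_k)$; $$H_{k+1}=H_k-\frac{H_k\gamma_k\delta_k^*+\delta_k\gamma_k^*H_k}{\langle\gamma_k,\delta_k\rangle}+\Bigl(\frac{\langle\gamma_k,H_k\gamma_k\rangle}{\langle\gamma_k,\delta_k\rangle}+1\Bigr)\frac{\delta_k\delta_k^*}{\langle\gamma_k,\delta_k\rangle},$$ where, e.g., $(\delta\delta^* )s=\langle s,\delta\rangle\delta$ and $(H\gamma\delta^* )s=\langle s,\delta\rangle H\gamma$. Equivalently, $G_k:=H_k^{-1}$ satisfies $G_{k+1}=G_k-\frac{G_k\delta_k\delta_k^*G_k}{\langle G_k\delta_k,\delta_k\rangle}+\frac{\gamma_k\gamma_k^*}{\langle\gamma_k,\delta_k\rangle}$.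 Standing assumption: $\langle\gamma_k,\delta_k\rangle>0$ for all $k\ge0$ (otherwise the method has already found the minimizer). All $H_k$ are then positive definite. *)

theory Defs
  imports "HOL-Analysis.Analysis"
begin

text \<open>
  The primal space is an arbitrary type of class \<open>euclidean_space\<close>. Its built-in inner product
  serves only to provide the topology and a basis; the geometry of the problem is given by an
  operator \<open>B\<close> from the space to its dual.
\<close>

type_synonym 'a dual = "'a \<Rightarrow>\<^sub>L real"

abbreviation pairing :: "'a::euclidean_space dual \<Rightarrow> 'a \<Rightarrow> real" ("\<langle>_, _\<rangle>")
  where "\<langle>s, x\<rangle> \<equiv> blinfun_apply s x"

definition pos_def :: "('a::euclidean_space \<Rightarrow> 'a dual) \<Rightarrow> bool" where
  "pos_def G \<longleftrightarrow> linear G \<and> (\<forall>x y. \<langle>G x, y\<rangle> = \<langle>G y, x\<rangle>) \<and> (\<forall>x. x \<noteq> 0 \<longrightarrow> 0 < \<langle>G x, x\<rangle>)"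

definition pos_def_dual :: "('a::euclidean_space dual \<Rightarrow> 'a) \<Rightarrow> bool" where
  "pos_def_dual H \<longleftrightarrow> linear H \<and> (\<forall>s t. \<langle>s, H t\<rangle> = \<langle>t, H s\<rangle>) \<and> (\<forall>s. s \<noteq> 0 \<longrightarrow> 0 < \<langle>s, H s\<rangle>)"

definition primal_norm :: "('a::euclidean_space \<Rightarrow> 'a dual) \<Rightarrow> 'a \<Rightarrow> real" where
  "primal_norm B u = sqrt \<langle>B u, u\<rangle>"

definition dual_norm :: "('a::euclidean_space \<Rightarrow> 'a dual) \<Rightarrow> 'a dual \<Rightarrow> real" where
  "dual_norm B s = sqrt \<langle>s, inv B s\<rangle>"

text \<open>
  \<open>trace\<close> and \<open>det\<close> of the library are defined for matrices indexed by a finite type. We make the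
  standard basis such a type; trace and determinant of an endomorphism are those of its matrix
  (and, as usual, do not depend on the basis).
\<close>

typedef (overloaded) 'a basis_index = "Basis :: 'a::euclidean_space set"
  by (rule ex_in_conv[THEN iffD2, OF nonempty_Basis])

instance basis_index :: (euclidean_space) finite
proof
  have "(UNIV :: 'a basis_index set) = Abs_basis_index ` Basis"
    using type_definition.Abs_image[OF type_definition_basis_index] by auto
  then show "finite (UNIV :: 'a basis_index set)"
    using finite_Basis by (metis finite_imageI)
qed

definition op_matrix ::
  "('a::euclidean_space \<Rightarrow> 'a) \<Rightarrow> real ^ 'a basis_index ^ 'a basis_index" where
  "op_matrix T = (\<chi> i j. T (Rep_basis_index j) \<bullet> Rep_basis_index i)"

definition op_trace :: "('a::euclidean_space \<Rightarrow> 'a) \<Rightarrow> real" where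
  "op_trace T = trace (op_matrix T)"

definition op_det :: "('a::euclidean_space \<Rightarrow> 'a) \<Rightarrow> real" where
  "op_det T = det (op_matrix T)"

definition psi :: "('a::euclidean_space \<Rightarrow> 'a dual) \<Rightarrow> ('a \<Rightarrow> 'a dual) \<Rightarrow> real" where
  "psi X Y = op_trace (\<lambda>u. inv X (Y u - X u)) - ln (op_det (\<lambda>u. inv X (Y u)))"

definition bfgs_update ::
  "('a::euclidean_space dual \<Rightarrow> 'a) \<Rightarrow> 'a \<Rightarrow> 'a dual \<Rightarrow> ('a dual \<Rightarrow> 'a)" where
  "bfgs_update H \<delta> \<gamma> = (\<lambda>s.
     H s - (1 / \<langle>\<gamma>, \<delta>\<rangle>) *\<^sub>R (\<langle>s, \<delta>\<rangle> *\<^sub>R H \<gamma> + \<langle>\<gamma>, H s\<rangle> *\<^sub>R \<delta>)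
         + ((\<langle>\<gamma>, H \<gamma>\<rangle> / \<langle>\<gamma>, \<delta>\<rangle> + 1) / \<langle>\<gamma>, \<delta>\<rangle>) *\<^sub>R (\<langle>s, \<delta>\<rangle> *\<^sub>R \<delta>))"

text \<open>
  \<open>g\<close> is the gradient map. The last conjunct is the standing assumption that the method has not
  already found the minimizer.
\<close>

definition bfgs_method ::
  "('a::euclidean_space \<Rightarrow> 'a dual) \<Rightarrow> (nat \<Rightarrow> 'a) \<Rightarrow> (nat \<Rightarrow> 'a dual \<Rightarrow> 'a) \<Rightarrow>
   (nat \<Rightarrow> 'a) \<Rightarrow> (nat \<Rightarrow> real) \<Rightarrow> bool" where
  "bfgs_method g x H d h \<longleftrightarrow> (\<forall>k.
     d k = H k (g (x k)) \<and>
     h k > 0 \<and>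
     x (Suc k) = x k - h k *\<^sub>R d k \<and>
     (let \<delta> = x (Suc k) - x k; \<gamma> = g (x (Suc k)) - g (x k)
      in H (Suc k) = bfgs_update (H k) \<delta> \<gamma> \<and> \<langle>\<gamma>, \<delta>\<rangle> > 0))"

end

theory Submission
  imports Defs
begin

text \<open>
  Measure everything in the metric \<open>X = L B\<close> and let \<open>G\<^sub>k\<close> be the inverse of \<open>H\<^sub>k\<close>. Cocoercivity
  bounds the trace gained in one update by 1, strong convexity bounds the determinant from below, and
  \<open>ln a \<le> a - 1\<close> gives \<open>\<psi>(X, G\<^sub>k\<^sub>+\<^sub>1) \<le> \<psi>(X, G\<^sub>k) + ln \<kappa> + ln cos\<^sup>2 \<theta>\<^sub>k\<close>, where \<open>\<theta>\<^sub>k\<close> is the angle between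
  the gradient and the direction. As \<open>\<psi> \<ge> 0\<close>, for \<open>k \<ge> 2 \<psi>\<^sub>0\<close> the mean of the \<open>cos\<^sup>2 \<theta>\<^sub>i\<close>, \<open>i < k\<close>, is at
  least \<open>1 / (2 \<kappa>)\<close>. Step \<open>i\<close> contracts the gap \<open>f - f\<^sup>*\<close> by the factor \<open>1 - 2 \<eta> cos\<^sup>2 \<theta>\<^sub>i / \<kappa>\<close>, and the
  inequality of the arithmetic and geometric means combines the factors.
\<close>

section \<open>Operators between a space and its dual\<close>

text \<open>Represents a functional through the built-in inner product, independently of
  \<open>B\<close>. It turns maps between the space and its dual into endomorphisms, for which
  injectivity implies surjectivity.\<close>

definition riesz :: "'a::euclidean_space dual \<Rightarrow> 'a" where
  "riesz s = (\<Sum>b\<in>Basis. \<langle>s, b\<rangle> *\<^sub>R b)"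

lemma riesz_inner: "riesz s \<bullet> x = \<langle>s, x\<rangle>"
proof -
  have "\<langle>s, x\<rangle> = \<langle>s, \<Sum>b\<in>Basis. (x \<bullet> b) *\<^sub>R b\<rangle>"
    by (simp add: euclidean_representation)
  also have "\<dots> = riesz s \<bullet> x"
    by (simp add: riesz_def blinfun.sum_right blinfun.scaleR_right inner_sum_left
        inner_commute[of x] mult.commute)
  finally show ?thesis by simp
qed

lemma linear_riesz: "linear riesz"
  by (rule linearI) (simp_all add: riesz_def blinfun.bilinear_simps sum.distrib scaleR_sum_right
      scaleR_add_left)

lemma inj_riesz: "inj riesz"
  by (rule injI, rule blinfun_eqI) (simp flip: riesz_inner)

lemma bij_riesz: "bij riesz"
proof (rule bijI[OF inj_riesz], rule surjI)
  fix x :: 'a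
  show "riesz (blinfun_inner_right x) = x"
    by (rule euclidean_eqI) (simp add: riesz_inner)
qed

lemma linear_inv_bij:
  assumes "linear F" "bij F"
  shows "linear (inv F)"
proof (rule linearI)
  have inv: "inv F (F x) = x" "F (inv F y) = y" for x y
    using assms(2) by (simp_all add: bij_is_inj bij_is_surj surj_f_inv_f)
  show "inv F (a + b) = inv F a + inv F b" for a b
    by (metis inv linear_add[OF assms(1)])
  show "inv F (c *\<^sub>R a) = c *\<^sub>R inv F a" for c a
    by (metis inv linear_scale[OF assms(1)])
qed

lemma linear_inv_riesz: "linear (inv riesz)"
  by (rule linear_inv_bij[OF linear_riesz bij_riesz])

lemma inj_linear_dual_imp_bij:
  fixes G :: "'a::euclidean_space \<Rightarrow> 'a dual"
  assumes "linear G" "inj G"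
  shows "bij G"
proof -
  have "linear (riesz \<circ> G)" "inj (riesz \<circ> G)"
    using linear_compose[OF assms(1) linear_riesz] inj_compose[OF inj_riesz assms(2)] by auto
  then have "bij (riesz \<circ> G)"
    using linear_injective_imp_surjective by (blast intro: bijI)
  then have "bij (inv riesz \<circ> (riesz \<circ> G))"
    using bij_riesz bij_comp bij_imp_bij_inv by blast
  then show ?thesis
    by (simp add: o_assoc inv_o_cancel[OF inj_riesz])
qed

lemma pos_def_linear: "pos_def G \<Longrightarrow> linear G"
  and pos_def_sym: "pos_def G \<Longrightarrow> \<langle>G x, y\<rangle> = \<langle>G y, x\<rangle>"
  and pos_def_pos: "pos_def G \<Longrightarrow> x \<noteq> 0 \<Longrightarrow> 0 < \<langle>G x, x\<rangle>"
  unfolding pos_def_def by blast+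

lemma pos_def_nonneg: "pos_def G \<Longrightarrow> 0 \<le> \<langle>G x, x\<rangle>"
  using pos_def_pos[of G x] by (cases "x = 0") auto

lemma pos_def_bij:
  assumes "pos_def G"
  shows "bij G"
proof (rule inj_linear_dual_imp_bij[OF pos_def_linear[OF assms]])
  show "inj G"
    using assms pos_def_pos[OF assms] linear_injective_0[OF pos_def_linear[OF assms]]
    by (metis blinfun.zero_left less_irrefl)
qed

lemma pos_def_inv_simps [simp]:
  assumes "pos_def G"
  shows "inv G (G x) = x" "G (inv G s) = s"
  using pos_def_bij[OF assms] by (simp_all add: bij_is_inj bij_is_surj surj_f_inv_f)

lemma pos_def_linear_inv: "pos_def G \<Longrightarrow> linear (inv G)"
  by (rule linear_inv_bij[OF pos_def_linear pos_def_bij])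

lemma pos_def_inv_sym: "pos_def G \<Longrightarrow> \<langle>s, inv G t\<rangle> = \<langle>t, inv G s\<rangle>"
  using pos_def_sym[of G "inv G s" "inv G t"] by simp

lemma pos_def_inv_pos: "pos_def G \<Longrightarrow> s \<noteq> 0 \<Longrightarrow> 0 < \<langle>s, inv G s\<rangle>"
  using pos_def_pos[of G "inv G s"] pos_def_inv_simps(2)[of G s] linear_0[OF pos_def_linear]
  by fastforce

lemma pos_def_inv_nonneg: "pos_def G \<Longrightarrow> 0 \<le> \<langle>s, inv G s\<rangle>"
  using pos_def_nonneg[of G "inv G s"] by simp

lemma pos_def_dual_bij:
  assumes "pos_def_dual H"
  shows "bij H"
proof -
  have lin: "linear H" and pos: "\<And>s. s \<noteq> 0 \<Longrightarrow> 0 < \<langle>s, H s\<rangle>"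
    using assms by (auto simp: pos_def_dual_def)
  have "inj H"
    using linear_injective_0[OF lin] pos by (metis blinfun.zero_right less_irrefl)
  then have "inj (H \<circ> inv riesz)" "linear (H \<circ> inv riesz)"
    using inj_compose[OF _ bij_is_inj[OF bij_imp_bij_inv[OF bij_riesz]]]
      linear_compose[OF linear_inv_riesz lin] by auto
  then have "bij (H \<circ> inv riesz)"
    using linear_injective_imp_surjective by (blast intro: bijI)
  then have "bij ((H \<circ> inv riesz) \<circ> riesz)"
    using bij_riesz bij_comp by blast
  then show ?thesis
    by (simp add: comp_assoc inv_o_cancel[OF inj_riesz])
qed

lemma pos_def_inv_dual:
  assumes "pos_def_dual H"
  shows "pos_def (inv H)"
proof -
  have bij: "bij H" by (rule pos_def_dual_bij[OF assms])
  have lin: "linear H" and sym: "\<And>s t. \<langle>s, H t\<rangle> = \<langle>t, H s\<rangle>"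
    and pos: "\<And>s. s \<noteq> 0 \<Longrightarrow> 0 < \<langle>s, H s\<rangle>"
    using assms by (auto simp: pos_def_dual_def)
  have H: "H (inv H x) = x" for x
    using bij by (simp add: bij_is_surj surj_f_inv_f)
  show ?thesis
    unfolding pos_def_def
  proof (intro conjI allI impI)
    show "linear (inv H)"
      by (rule linear_inv_bij[OF lin bij])
    show "\<langle>inv H x, y\<rangle> = \<langle>inv H y, x\<rangle>" for x y
      by (metis H sym)
    show "0 < \<langle>inv H x, x\<rangle>" if "x \<noteq> 0" for x
      by (metis H linear_0 lin pos that)
  qed
qed

lemma pos_def_scaleR:
  assumes "pos_def G" "0 < c"
  shows "pos_def (\<lambda>u. c *\<^sub>R G u)"
  using assms unfolding pos_def_def
  by (auto simp: blinfun.scaleR_left linear_compose_scale_right)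

text \<open>Young's inequality in the metric \<open>G\<close> with weight \<open>c\<close>: expand
  the square of \<open>x - c *\<^sub>R inv G s\<close>.\<close>

lemma pos_def_discriminant:
  assumes "pos_def G" "0 < c"
  shows "2 * \<langle>s, x\<rangle> \<le> c * \<langle>s, inv G s\<rangle> + \<langle>G x, x\<rangle> / c"
proof -
  let ?y = "inv G s"
  have "0 \<le> \<langle>G (x - c *\<^sub>R ?y), x - c *\<^sub>R ?y\<rangle>"
    by (rule pos_def_nonneg[OF assms(1)])
  also have "\<dots> = \<langle>G x, x\<rangle> - 2 * c * \<langle>s, x\<rangle> + c * c * \<langle>s, ?y\<rangle>"
    using pos_def_sym[OF assms(1), of x ?y] pos_def_linear[OF assms(1)] assms(1)
    by (simp add: linear_diff linear_scale blinfun.bilinear_simps algebra_simps)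
  finally show ?thesis
    using assms(2) by (simp add: field_simps)
qed

lemma pos_def_Cauchy_Schwarz:
  assumes "pos_def G"
  shows "\<langle>s, x\<rangle>\<^sup>2 \<le> \<langle>s, inv G s\<rangle> * \<langle>G x, x\<rangle>"
proof (cases "\<langle>s, x\<rangle> = 0")
  case True
  then show ?thesis
    using pos_def_inv_nonneg[OF assms] pos_def_nonneg[OF assms] by simp
next
  case False
  then have "s \<noteq> 0" by auto
  then have N: "0 < \<langle>s, inv G s\<rangle>" by (rule pos_def_inv_pos[OF assms])
  \<comment> \<open>The part of \<open>x\<close> that is \<open>G\<close>-orthogonal to
    \<open>inv G s\<close>, multiplied by \<open>\<langle>s, inv G s\<rangle>\<close> to avoid a
    division.\<close>
  let ?y = "\<langle>s, inv G s\<rangle> *\<^sub>R x - \<langle>s, x\<rangle> *\<^sub>R inv G s"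
  have "0 \<le> \<langle>G ?y, ?y\<rangle>"
    by (rule pos_def_nonneg[OF assms])
  also have "\<dots> = \<langle>s, inv G s\<rangle> * (\<langle>s, inv G s\<rangle> * \<langle>G x, x\<rangle> - \<langle>s, x\<rangle>\<^sup>2)"
    using pos_def_sym[OF assms, of x "inv G s"] pos_def_linear[OF assms] assms
    by (simp add: linear_diff linear_scale blinfun.bilinear_simps algebra_simps power2_eq_square)
  finally show ?thesis
    using N by (simp add: zero_le_mult_iff)
qed

section \<open>Trace and determinant of an endomorphism\<close>

lemma bij_betw_Rep_basis_index:
  "bij_betw Rep_basis_index UNIV (Basis :: 'a::euclidean_space set)"
  by (simp add: bij_betw_def inj_on_def Rep_basis_index_inject
      type_definition.Rep_range[OF type_definition_basis_index])

lemma sum_basis_index: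
  "(\<Sum>i\<in>UNIV. F (Rep_basis_index i)) = (\<Sum>b\<in>(Basis :: 'a::euclidean_space set). F b)"
  by (rule sum.reindex_bij_betw[OF bij_betw_Rep_basis_index])

lemma op_matrix_comp:
  assumes "linear S"
  shows "op_matrix (\<lambda>u. S (T u)) = op_matrix S ** op_matrix T"
proof -
  have "S (T b) \<bullet> c = (\<Sum>k\<in>Basis. (S k \<bullet> c) * (T b \<bullet> k))" for b c
  proof -
    have "S (T b) \<bullet> c = S (\<Sum>k\<in>Basis. (T b \<bullet> k) *\<^sub>R k) \<bullet> c"
      by (simp add: euclidean_representation)
    then show ?thesis
      by (simp add: linear_sum[OF assms] linear_scale[OF assms] inner_sum_left mult.commute)
  qed
  then show ?thesis
    by (simp add: op_matrix_def matrix_matrix_mult_def vec_eq_iff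
        sum_basis_index[symmetric])
qed

lemma op_det_comp: "linear S \<Longrightarrow> op_det (\<lambda>u. S (T u)) = op_det S * op_det T"
  by (simp add: op_det_def op_matrix_comp det_mul)

lemma op_det_id: "op_det (\<lambda>u. u) = 1"
proof -
  have "op_matrix (\<lambda>u::'a::euclidean_space. u) = mat 1"
    by (auto simp: op_matrix_def mat_def vec_eq_iff inner_Basis Rep_basis_index
        Rep_basis_index_inject)
  then show ?thesis by (simp add: op_det_def)
qed

lemma matrix_add_rdistrib: "(A + B) ** C = A ** C + B ** (C :: real ^ 'n ^ 'm)"
  by (simp add: vec_eq_iff matrix_matrix_mult_def distrib_right sum.distrib)

text \<open>An orthogonal change of basis taking \<open>s\<close> to a multiple of a basis vector leaves a matrix
  that differs from the identity in one column only, to which Cramer's lemma applies.\<close>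

lemma det_mat_1_plus_rank_one:
  fixes v s :: "real ^ 'n"
  shows "det (mat 1 + (\<chi> i j. v $ i * s $ j)) = 1 + v \<bullet> s"
proof (cases "s = 0")
  case True
  then have "(\<chi> i j. v $ i * s $ j) = 0" by (simp add: vec_eq_iff)
  then show ?thesis using True by simp
next
  case False
  fix k :: 'n
  obtain A where A: "orthogonal_matrix A" "A *v axis k 1 = (1 / norm s) *\<^sub>R s"
    using orthogonal_matrix_exists_basis[of "(1 / norm s) *\<^sub>R s" k] False by auto
  define w where "w = transpose A *v v"
  let ?R = "\<chi> i j. v $ i * s $ j"
  have AA: "transpose A ** A = mat 1"
    using A(1) by (simp add: orthogonal_matrix)
  have As: "norm s *\<^sub>R axis k 1 = transpose A *v s"
  proof -
    have "s = norm s *\<^sub>R (A *v axis k 1)" using False A(2) by simp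
    then show ?thesis
      by (metis AA matrix_vector_mul_assoc matrix_vector_mult_scaleR matrix_vector_mul_lid)
  qed
  then have "(norm s *\<^sub>R axis k 1) $ i = (transpose A *v s) $ i" for i
    by simp
  then have s: "(\<Sum>j\<in>UNIV. A $ j $ i * s $ j) = (if i = k then norm s else 0)" for i
    by (auto simp: matrix_vector_mult_def transpose_def axis_def dest: meta_spec[of _ i])
  have "transpose A ** ?R ** A = (\<chi> i j. w $ i * (\<Sum>l\<in>UNIV. A $ l $ j * s $ l))"
    by (simp add: vec_eq_iff matrix_matrix_mult_def w_def matrix_vector_mult_def transpose_def
        sum_distrib_left sum_distrib_right mult_ac, intro allI, subst sum.swap, simp add: mult_ac)
  then have R: "transpose A ** ?R ** A = (\<chi> i j. if j = k then norm s * w $ i else 0)"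
    by (simp add: s vec_eq_iff)
  have "transpose A ** (mat 1 + ?R) ** A = mat 1 + transpose A ** ?R ** A"
    by (simp add: matrix_add_ldistrib matrix_add_rdistrib AA)
  \<comment> \<open>The shape of Cramer's lemma for \<open>mat 1\<close>: column \<open>k\<close> is
    replaced by the image of a vector, so the determinant is entry \<open>k\<close> of that
    vector.\<close>
  also have "\<dots> = (\<chi> i j. if j = k then (mat 1 *v (axis k 1 + norm s *\<^sub>R w)) $ i else mat 1 $ i $ j)"
    unfolding R matrix_vector_mul_lid by (auto simp: vec_eq_iff mat_def axis_def)
  finally have "det (transpose A ** (mat 1 + ?R) ** A) = 1 + norm s * w $ k"
    by (simp only: cramer_lemma) (simp add: axis_def)
  moreover have "det A * det A = 1"
    using arg_cong[OF AA, of det] by (simp add: det_mul det_transpose)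
  then have "det (transpose A ** (mat 1 + ?R) ** A) = det (mat 1 + ?R)"
    by (simp add: det_mul det_transpose mult.assoc mult.left_commute[of "det A"])
  moreover have "norm s * w $ k = v \<bullet> s"
  proof -
    have "norm s * w $ k = w \<bullet> (norm s *\<^sub>R axis k 1)" by (simp add: inner_axis)
    also have "\<dots> = (transpose A *v v) \<bullet> (transpose A *v s)"
      using As by (simp add: w_def)
    also have "\<dots> = v \<bullet> s"
      using A(1)
      unfolding transpose_matrix_vector[of A v] dot_lmul_matrix matrix_vector_mul_assoc
      by (simp add: orthogonal_matrix_def)
    finally show ?thesis .
  qed
  ultimately show ?thesis by simp
qed

text \<open>The matrix determinant lemma in coordinate-free form.\<close>

lemma op_det_rank_one: "op_det (\<lambda>u. u + \<langle>s, u\<rangle> *\<^sub>R v) = 1 + \<langle>s, v\<rangle>"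
proof -
  let ?v = "\<chi> i. v \<bullet> Rep_basis_index i" and ?s = "\<chi> i. \<langle>s, Rep_basis_index i\<rangle>"
  have "op_matrix (\<lambda>u. u + \<langle>s, u\<rangle> *\<^sub>R v) = mat 1 + (\<chi> i j. ?v $ i * ?s $ j)"
    by (auto simp: op_matrix_def mat_def vec_eq_iff inner_Basis Rep_basis_index
        Rep_basis_index_inject inner_add_left)
  moreover have "?v \<bullet> ?s = \<langle>s, v\<rangle>"
  proof -
    have "?v \<bullet> ?s = (\<Sum>b\<in>Basis. (v \<bullet> b) * \<langle>s, b\<rangle>)"
      by (simp add: inner_vec_def sum_basis_index[where F = "\<lambda>b. (v \<bullet> b) * \<langle>s, b\<rangle>"])
    also have "\<dots> = \<langle>s, \<Sum>b\<in>Basis. (v \<bullet> b) *\<^sub>R b\<rangle>"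
      by (simp add: blinfun.sum_right blinfun.scaleR_right)
    finally show ?thesis by (simp add: euclidean_representation)
  qed
  ultimately show ?thesis by (simp add: op_det_def det_mat_1_plus_rank_one del: vec_lambda_beta)
qed

lemma op_trace_eq: "op_trace T = (\<Sum>b\<in>Basis. T b \<bullet> b)"
  by (simp add: op_trace_def trace_def op_matrix_def sum_basis_index[where F = "\<lambda>b. T b \<bullet> b"])

lemma op_trace_add: "op_trace (\<lambda>u. S u + T u) = op_trace S + op_trace T"
  by (simp add: op_trace_eq inner_add_left sum.distrib)

lemma op_trace_rank_one: "op_trace (\<lambda>u. \<langle>s, u\<rangle> *\<^sub>R v) = \<langle>s, v\<rangle>"
proof -
  have "op_trace (\<lambda>u. \<langle>s, u\<rangle> *\<^sub>R v) = \<langle>s, \<Sum>b\<in>Basis. (v \<bullet> b) *\<^sub>R b\<rangle>"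
    by (simp add: op_trace_eq blinfun.sum_right blinfun.scaleR_right mult.commute)
  then show ?thesis by (simp add: euclidean_representation)
qed

section \<open>The BFGS update of the Hessian approximation\<close>

text \<open>What the method does to the inverse of \<open>H\<close>, as
  \<open>bfgs_update_inverse\<close> shows. In this form the change is a sum of two rank-one terms,
  whose traces are immediate.\<close>

definition bfgs_direct ::
  "('a::euclidean_space \<Rightarrow> 'a dual) \<Rightarrow> 'a \<Rightarrow> 'a dual \<Rightarrow> ('a \<Rightarrow> 'a dual)" where
  "bfgs_direct G \<delta> \<gamma> = (\<lambda>v.
     G v - (\<langle>G \<delta>, v\<rangle> / \<langle>G \<delta>, \<delta>\<rangle>) *\<^sub>R G \<delta> + (\<langle>\<gamma>, v\<rangle> / \<langle>\<gamma>, \<delta>\<rangle>) *\<^sub>R \<gamma>)"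

lemma linear_bfgs_direct:
  assumes "linear G"
  shows "linear (bfgs_direct G \<delta> \<gamma>)"
  by (rule linearI) (simp_all add: bfgs_direct_def linear_add[OF assms] linear_scale[OF assms]
      blinfun.bilinear_simps add_divide_distrib algebra_simps)

text \<open>The update is a congruence \<open>G \<mapsto> E G E\<^sup>*\<close> where \<open>E\<^sup>* v = v + \<langle>u, v\<rangle> \<delta>\<close>; this yields positive
  definiteness and the determinant at once.\<close>

definition bfgs_shear ::
  "('a::euclidean_space \<Rightarrow> 'a dual) \<Rightarrow> 'a \<Rightarrow> 'a dual \<Rightarrow> 'a dual" where
  "bfgs_shear G \<delta> \<gamma> = (1 / sqrt (\<langle>\<gamma>, \<delta>\<rangle> * \<langle>G \<delta>, \<delta>\<rangle>)) *\<^sub>R \<gamma> - (1 / \<langle>G \<delta>, \<delta>\<rangle>) *\<^sub>R G \<delta>"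

text \<open>With the chosen coefficient of \<open>G \<delta>\<close> in \<open>u\<close>, the
  requirement that \<delta> be sent to \<gamma> fixes the coefficient of \<gamma> up to sign; hence
  the square root. The second claim is the factor by which the shear stretches \<delta>; its square
  becomes the change of the determinant.\<close>

lemma bfgs_direct_factor:
  fixes G :: "'a::euclidean_space \<Rightarrow> 'a dual"
  assumes G: "pos_def G" and m: "0 < \<langle>\<gamma>, \<delta>\<rangle>"
  defines "u \<equiv> bfgs_shear G \<delta> \<gamma>"
  defines "F \<equiv> (\<lambda>v. v + \<langle>u, v\<rangle> *\<^sub>R \<delta>)"
  shows "bfgs_direct G \<delta> \<gamma> v = G (F v) + \<langle>G (F v), \<delta>\<rangle> *\<^sub>R u"
    and "1 + \<langle>u, \<delta>\<rangle> = sqrt (\<langle>\<gamma>, \<delta>\<rangle> / \<langle>G \<delta>, \<delta>\<rangle>)"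
proof -
  define m' c r p q where "m' = \<langle>\<gamma>, \<delta>\<rangle>" and "c = \<langle>G \<delta>, \<delta>\<rangle>" and "r = sqrt (m' * c)"
    and "p = \<langle>\<gamma>, v\<rangle>" and "q = \<langle>G \<delta>, v\<rangle>"
  have "\<delta> \<noteq> 0" using m by auto
  then have c: "0 < c" using pos_def_pos[OF G] by (simp add: c_def)
  have m': "0 < m'" using m by (simp add: m'_def)
  have r: "0 < r" "r * r = m' * c" using c m' by (auto simp: r_def)
  have u: "u = (1 / r) *\<^sub>R \<gamma> - (1 / c) *\<^sub>R G \<delta>"
    by (simp add: u_def bfgs_shear_def r_def c_def m'_def)
  have q: "\<langle>G v, \<delta>\<rangle> = q" by (simp add: q_def pos_def_sym[OF G])
  have uv: "\<langle>u, v\<rangle> = p / r - q / c"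
    by (simp add: u p_def q_def blinfun.bilinear_simps)
  have GF: "G (F v) = G v + (p / r - q / c) *\<^sub>R G \<delta>"
    using pos_def_linear[OF G] by (simp add: F_def linear_add linear_scale uv)
  have GFd: "\<langle>G (F v), \<delta>\<rangle> = p * c / r"
    using c by (simp add: GF blinfun.bilinear_simps q c_def[symmetric] field_simps)
  have "p * c / r * (1 / r) = p / m'"
    using r c m' by (simp add: field_simps)
  then have "G (F v) + \<langle>G (F v), \<delta>\<rangle> *\<^sub>R u = G v - (q / c) *\<^sub>R G \<delta> + (p / m') *\<^sub>R \<gamma>"
    unfolding GFd unfolding GF u scaleR_right_diff_distrib scaleR_scaleR
    using c by (simp add: scaleR_left_diff_distrib)
  then show "bfgs_direct G \<delta> \<gamma> v = G (F v) + \<langle>G (F v), \<delta>\<rangle> *\<^sub>R u"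
    by (simp add: bfgs_direct_def p_def q_def c_def m'_def)
  have "1 + \<langle>u, \<delta>\<rangle> = m' / r"
    using c by (simp add: u blinfun.bilinear_simps m'_def c_def)
  also have "\<dots> = sqrt (m' / c)"
    using m' c by (simp add: r_def real_sqrt_mult real_sqrt_divide real_div_sqrt field_simps)
  finally show "1 + \<langle>u, \<delta>\<rangle> = sqrt (\<langle>\<gamma>, \<delta>\<rangle> / \<langle>G \<delta>, \<delta>\<rangle>)"
    by (simp add: m'_def c_def)
qed

lemma pos_def_bfgs_direct:
  assumes G: "pos_def G" and m: "0 < \<langle>\<gamma>, \<delta>\<rangle>"
  shows "pos_def (bfgs_direct G \<delta> \<gamma>)"
  unfolding pos_def_def
proof (intro conjI allI impI)
  show "linear (bfgs_direct G \<delta> \<gamma>)"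
    by (rule linear_bfgs_direct[OF pos_def_linear[OF G]])
  show "\<langle>bfgs_direct G \<delta> \<gamma> x, y\<rangle> = \<langle>bfgs_direct G \<delta> \<gamma> y, x\<rangle>" for x y
    by (simp add: bfgs_direct_def blinfun.bilinear_simps pos_def_sym[OF G, of x y]
        mult.commute)
  fix x :: 'a
  assume x: "x \<noteq> 0"
  define u where "u = bfgs_shear G \<delta> \<gamma>"
  define y where "y = x + \<langle>u, x\<rangle> *\<^sub>R \<delta>"
  note factor = bfgs_direct_factor[OF G m, folded u_def]
  have "\<delta> \<noteq> 0" using m by auto
  then have "0 < \<langle>G \<delta>, \<delta>\<rangle>" by (rule pos_def_pos[OF G])
  then have nz: "1 + \<langle>u, \<delta>\<rangle> \<noteq> 0" using factor(2) m by simp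
  \<comment> \<open>The shear multiplies the value of \<open>u\<close> by the nonzero number
    \<open>1 + \<langle>u, \<delta>\<rangle>\<close>, so it is injective.\<close>
  have "y \<noteq> 0"
  proof
    assume y: "y = 0"
    then have "\<langle>u, y\<rangle> = 0" by simp
    then have "\<langle>u, x\<rangle> * (1 + \<langle>u, \<delta>\<rangle>) = 0"
      unfolding y_def by (simp add: blinfun.bilinear_simps algebra_simps)
    then show False using nz x y by (simp add: y_def)
  qed
  then have "0 < \<langle>G y, y\<rangle>" by (rule pos_def_pos[OF G])
  also have "\<dots> = \<langle>bfgs_direct G \<delta> \<gamma> x, x\<rangle>"
    using factor(1)[of x] by (simp add: y_def[symmetric]) (simp add: y_def blinfun.bilinear_simps)
  finally show "0 < \<langle>bfgs_direct G \<delta> \<gamma> x, x\<rangle>" .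
qed

text \<open>As the direct update is bijective, it suffices that it undoes
  \<open>bfgs_update\<close>. It sends \<delta> to \<gamma>, and its values on \<open>H t\<close>
  are explicit because \<open>\<langle>G \<delta>, H t\<rangle> = \<langle>t,
  \<delta>\<rangle>\<close>; the terms in \<open>G \<delta>\<close> and \<gamma> then
  cancel.\<close>

lemma bfgs_update_inverse:
  assumes H: "pos_def_dual H" and G: "G = inv H" and m: "0 < \<langle>\<gamma>, \<delta>\<rangle>"
  shows "bfgs_update H \<delta> \<gamma> = inv (bfgs_direct G \<delta> \<gamma>)"
proof -
  have bijH: "bij H" by (rule pos_def_dual_bij[OF H])
  have pG: "pos_def G" unfolding G by (rule pos_def_inv_dual[OF H])
  have GH [simp]: "G (H s) = s" for s
    using bijH by (simp add: G bij_is_inj)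
  let ?G' = "bfgs_direct G \<delta> \<gamma>"
  have pG': "pos_def ?G'" by (rule pos_def_bfgs_direct[OF pG m])
  have "\<delta> \<noteq> 0" using m by auto
  then have c: "0 < \<langle>G \<delta>, \<delta>\<rangle>" by (rule pos_def_pos[OF pG])
  have "?G' (bfgs_update H \<delta> \<gamma> s) = s" for s
  proof -
    define m' c' q where "m' = \<langle>\<gamma>, \<delta>\<rangle>" and "c' = \<langle>G \<delta>, \<delta>\<rangle>" and "q = \<langle>\<gamma>, H \<gamma>\<rangle>"
    have m'0: "m' > 0" and c'0: "c' > 0" using m c by (simp_all add: m'_def c'_def)
    have linG': "linear ?G'" by (rule linear_bfgs_direct[OF pos_def_linear[OF pG]])
    have H\<delta>: "\<langle>G \<delta>, H t\<rangle> = \<langle>t, \<delta>\<rangle>" for t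
      by (metis GH pG pos_def_sym)
    have G'\<delta>: "?G' \<delta> = \<gamma>"
      using m c by (simp add: bfgs_direct_def)
    have G'H: "?G' (H t) = t - (\<langle>t, \<delta>\<rangle> / c') *\<^sub>R G \<delta> + (\<langle>\<gamma>, H t\<rangle> / m') *\<^sub>R \<gamma>" for t
      by (simp add: bfgs_direct_def H\<delta> m'_def c'_def)
    have "?G' (bfgs_update H \<delta> \<gamma> s) =
        ?G' (H s) - (1 / m') *\<^sub>R (\<langle>s, \<delta>\<rangle> *\<^sub>R ?G' (H \<gamma>) + \<langle>\<gamma>, H s\<rangle> *\<^sub>R \<gamma>)
         + ((q / m' + 1) / m') *\<^sub>R (\<langle>s, \<delta>\<rangle> *\<^sub>R \<gamma>)"
      unfolding bfgs_update_def
      by (simp add: linear_add[OF linG'] linear_diff[OF linG'] linear_scale[OF linG'] G'\<delta>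
          m'_def q_def)
    also have "\<dots> = s"
      unfolding G'H q_def[symmetric] m'_def[symmetric]
      using m'0 c'0
      by (simp add: algebra_simps add_divide_distrib)
    finally show ?thesis .
  qed
  then show ?thesis
    using pos_def_inv_simps(1)[OF pG'] by (metis ext)
qed

lemma pos_def_dual_inv:
  assumes "pos_def G"
  shows "pos_def_dual (inv G)"
  unfolding pos_def_dual_def
  using pos_def_linear_inv[OF assms] pos_def_inv_sym[OF assms] pos_def_inv_pos[OF assms] by blast

lemma bfgs_update_direct:
  assumes H: "pos_def_dual H" and m: "0 < \<langle>\<gamma>, \<delta>\<rangle>"
  shows "pos_def_dual (bfgs_update H \<delta> \<gamma>)"
    and "inv (bfgs_update H \<delta> \<gamma>) = bfgs_direct (inv H) \<delta> \<gamma>"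
proof -
  have pG: "pos_def (bfgs_direct (inv H) \<delta> \<gamma>)"
    by (rule pos_def_bfgs_direct[OF pos_def_inv_dual[OF H] m])
  have eq: "bfgs_update H \<delta> \<gamma> = inv (bfgs_direct (inv H) \<delta> \<gamma>)"
    by (rule bfgs_update_inverse[OF H refl m])
  show "pos_def_dual (bfgs_update H \<delta> \<gamma>)"
    unfolding eq by (rule pos_def_dual_inv[OF pG])
  show "inv (bfgs_update H \<delta> \<gamma>) = bfgs_direct (inv H) \<delta> \<gamma>"
    unfolding eq by (rule inv_inv_eq[OF pos_def_bij[OF pG]])
qed

section \<open>The potential\<close>

text \<open>The operator and \<open>\<lambda>v. inv G (X v)\<close> are mutually inverse, so their
  determinants multiply to 1. This lets \<open>ln\<close> split over the product in
  \<open>psi_bfgs_direct\<close>.\<close>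

lemma op_det_inv_comp_nonzero:
  assumes X: "pos_def X" and G: "pos_def G"
  shows "op_det (\<lambda>v. inv X (G v)) \<noteq> 0"
proof -
  have lin: "linear (\<lambda>v. inv X (G v))"
    using linear_compose[OF pos_def_linear[OF G] pos_def_linear_inv[OF X]] by (simp add: o_def)
  have "op_det (\<lambda>v. inv X (G v)) * op_det (\<lambda>v. inv G (X v)) = 1"
    using op_det_comp[OF lin, of "\<lambda>v. inv G (X v)"] X G by (simp add: op_det_id)
  then show ?thesis by auto
qed

text \<open>After applying \<open>inv X\<close>, the congruence becomes a product with outer factors
  \<open>E\<close> and \<open>F\<close>, which are adjoint to each other in the metric
  \<open>X\<close>. Each is a rank-one perturbation of the identity with determinant
  \<open>1 + \<langle>u, \<delta>\<rangle>\<close>.\<close>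

lemma op_det_bfgs_direct:
  assumes X: "pos_def X" and G: "pos_def G" and m: "0 < \<langle>\<gamma>, \<delta>\<rangle>"
  shows "op_det (\<lambda>v. inv X (bfgs_direct G \<delta> \<gamma> v))
    = \<langle>\<gamma>, \<delta>\<rangle> / \<langle>G \<delta>, \<delta>\<rangle> * op_det (\<lambda>v. inv X (G v))"
proof -
  define u where "u = bfgs_shear G \<delta> \<gamma>"
  note factor = bfgs_direct_factor[OF G m, folded u_def]
  define F where "F = (\<lambda>v. v + \<langle>u, v\<rangle> *\<^sub>R \<delta>)"
  define E where "E = (\<lambda>v. v + \<langle>X \<delta>, v\<rangle> *\<^sub>R inv X u)"
  have lin: "linear (\<lambda>v. inv X (G v))"
    using linear_compose[OF pos_def_linear[OF G] pos_def_linear_inv[OF X]] by (simp add: o_def)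
  have linE: "linear E"
    by (rule linearI) (simp_all add: E_def blinfun.bilinear_simps algebra_simps)
  have "\<langle>X \<delta>, inv X s\<rangle> = \<langle>s, \<delta>\<rangle>" for s
    by (metis X pos_def_inv_simps(2) pos_def_sym)
  then have "inv X (bfgs_direct G \<delta> \<gamma> v) = E (inv X (G (F v)))" for v
    using factor(1)[of v, folded F_def] linear_add[OF pos_def_linear_inv[OF X]]
      linear_scale[OF pos_def_linear_inv[OF X]]
    by (simp add: E_def F_def)
  then have "op_det (\<lambda>v. inv X (bfgs_direct G \<delta> \<gamma> v))
      = op_det E * (op_det (\<lambda>v. inv X (G v)) * op_det F)"
    using op_det_comp[OF linE, of "\<lambda>v. inv X (G (F v))"] op_det_comp[OF lin, of F] by simp
  moreover have "op_det E = 1 + \<langle>u, \<delta>\<rangle>"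
    using \<open>\<And>s. \<langle>X \<delta>, inv X s\<rangle> = \<langle>s, \<delta>\<rangle>\<close> by (simp add: E_def op_det_rank_one)
  moreover have "op_det F = 1 + \<langle>u, \<delta>\<rangle>"
    by (simp add: F_def op_det_rank_one)
  moreover have "(1 + \<langle>u, \<delta>\<rangle>) * (1 + \<langle>u, \<delta>\<rangle>) = \<langle>\<gamma>, \<delta>\<rangle> / \<langle>G \<delta>, \<delta>\<rangle>"
    using m pos_def_nonneg[OF G, of \<delta>] by (simp add: factor(2))
  ultimately show ?thesis by (metis mult.assoc mult.commute)
qed

lemma psi_bfgs_direct:
  assumes X: "pos_def X" and G: "pos_def G" and m: "0 < \<langle>\<gamma>, \<delta>\<rangle>"
  shows "psi X (bfgs_direct G \<delta> \<gamma>) = psi X G - \<langle>G \<delta>, inv X (G \<delta>)\<rangle> / \<langle>G \<delta>, \<delta>\<rangle>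
    + \<langle>\<gamma>, inv X \<gamma>\<rangle> / \<langle>\<gamma>, \<delta>\<rangle> - ln (\<langle>\<gamma>, \<delta>\<rangle> / \<langle>G \<delta>, \<delta>\<rangle>)"
proof -
  have "\<delta> \<noteq> 0" using m by auto
  then have c: "0 < \<langle>G \<delta>, \<delta>\<rangle>" by (rule pos_def_pos[OF G])
  note lin = pos_def_linear_inv[OF X]
  have "inv X (bfgs_direct G \<delta> \<gamma> v - X v) =
      inv X (G v - X v) + (\<langle>- (1 / \<langle>G \<delta>, \<delta>\<rangle>) *\<^sub>R G \<delta>, v\<rangle> *\<^sub>R inv X (G \<delta>)
        + \<langle>(1 / \<langle>\<gamma>, \<delta>\<rangle>) *\<^sub>R \<gamma>, v\<rangle> *\<^sub>R inv X \<gamma>)" for v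
    by (simp add: bfgs_direct_def linear_add[OF lin] linear_diff[OF lin] linear_scale[OF lin]
        blinfun.bilinear_simps)
  then have "op_trace (\<lambda>v. inv X (bfgs_direct G \<delta> \<gamma> v - X v)) =
      op_trace (\<lambda>v. inv X (G v - X v)) - \<langle>G \<delta>, inv X (G \<delta>)\<rangle> / \<langle>G \<delta>, \<delta>\<rangle>
        + \<langle>\<gamma>, inv X \<gamma>\<rangle> / \<langle>\<gamma>, \<delta>\<rangle>"
    by (simp only: op_trace_add op_trace_rank_one) (simp add: blinfun.bilinear_simps)
  moreover have "ln (op_det (\<lambda>v. inv X (bfgs_direct G \<delta> \<gamma> v))) =
      ln (\<langle>\<gamma>, \<delta>\<rangle> / \<langle>G \<delta>, \<delta>\<rangle>) + ln (op_det (\<lambda>v. inv X (G v)))"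
    using op_det_inv_comp_nonzero[OF X G] m c
    by (simp only: op_det_bfgs_direct[OF X G m] ln_mult) simp
  ultimately show ?thesis by (simp add: psi_def)
qed

lemma psi_refl: "pos_def X \<Longrightarrow> psi X X = 0"
  by (simp add: psi_def op_det_id op_trace_eq linear_0[OF pos_def_linear_inv])

text \<open>Updating \<open>G\<close> with the exact data \<open>\<gamma> = X \<delta>\<close> does not increase the potential; along directions
  that are \<open>X\<close>-orthogonal to the space where \<open>G\<close> and \<open>X\<close> already agree, this reaches \<open>X\<close>, where
  the potential vanishes, in finitely many steps.\<close>

lemma psi_nonneg:
  assumes X: "pos_def X" and "pos_def G"
  shows "0 \<le> psi X G"
  using assms(2)
proof (induction "DIM('a) - dim {v. G v = X v}" arbitrary: G rule: less_induct)
  case less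
  note G = less.prems
  let ?S = "\<lambda>G. {v. G v = X v}"
  have sub: "subspace (?S G)" if "pos_def G" for G
    using pos_def_linear[OF X] pos_def_linear[OF that]
    by (auto simp: subspace_def linear_0 linear_add linear_scale)
  show ?case
  proof (cases "dim (?S G) < DIM('a)")
    case False
    then have "?S G = UNIV"
      using sub[OF G] dim_subset_UNIV[of "?S G"] by (metis dim_eq_full le_neq_implies_less span_eq_iff)
    then have "G = X" by auto
    then show ?thesis using psi_refl[OF X] by simp
  next
    case True
    \<comment> \<open>Orthogonality to the image under \<open>riesz \<circ> X\<close> in the
      built-in inner product is \<open>X\<close>-orthogonality to the vectors where \<open>G\<close>
      and \<open>X\<close> agree. The image is not the whole space, so a nonzero \<delta>
      exists.\<close>
    have "linear (riesz \<circ> X)" by (rule linear_compose[OF pos_def_linear[OF X] linear_riesz])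
    then have "dim ((riesz \<circ> X) ` ?S G) < DIM('a)"
      using True dim_image_le by (metis le_less_trans)
    then obtain \<delta> where \<delta>: "\<delta> \<noteq> 0" "\<And>y. y \<in> span ((riesz \<circ> X) ` ?S G) \<Longrightarrow> orthogonal \<delta> y"
      using orthogonal_to_subspace_exists by blast
    have orth: "\<langle>X v, \<delta>\<rangle> = 0" if "G v = X v" for v
      using \<delta>(2)[of "riesz (X v)"] that
      by (auto simp: span_base orthogonal_def inner_commute[of \<delta>] riesz_inner)
    have m: "0 < \<langle>X \<delta>, \<delta>\<rangle>" and c: "0 < \<langle>G \<delta>, \<delta>\<rangle>"
      using pos_def_pos[OF X \<delta>(1)] pos_def_pos[OF G \<delta>(1)] by auto
    define G' where "G' = bfgs_direct G \<delta> (X \<delta>)"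
    have pG': "pos_def G'" unfolding G'_def by (rule pos_def_bfgs_direct[OF G m])
    \<comment> \<open>On these vectors both rank-one corrections vanish, so the agreement survives
      the update.\<close>
    have sub': "?S G \<subseteq> ?S G'"
    proof
      fix v assume "v \<in> ?S G"
      then have v: "G v = X v" by simp
      then have "\<langle>G \<delta>, v\<rangle> = 0" "\<langle>X \<delta>, v\<rangle> = 0"
        using orth[OF v] pos_def_sym[OF G, of \<delta> v] pos_def_sym[OF X, of \<delta> v] by simp_all
      then show "v \<in> ?S G'" using v by (simp add: G'_def bfgs_direct_def)
    qed
    have "\<delta> \<in> ?S G'" using m c by (simp add: G'_def bfgs_direct_def)
    moreover have "\<delta> \<notin> ?S G" using orth m by fastforce
    ultimately have "?S G \<subset> ?S G'" using sub' by auto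
    then have "dim (?S G) < dim (?S G')"
      using sub[OF G] sub[OF pG'] by (metis dim_psubset span_eq_iff)
    then have "0 \<le> psi X G'"
      using less.hyps[OF _ pG'] dim_subset_UNIV[of "?S G'"] by simp
    \<comment> \<open>With exact data the trace gained is 1. It cancels against the -1 in
      \<open>ln t \<le> t - 1\<close>, and Cauchy-Schwarz bounds the remaining quotient by the trace
      lost.\<close>
    also have "psi X G' = psi X G - \<langle>G \<delta>, inv X (G \<delta>)\<rangle> / \<langle>G \<delta>, \<delta>\<rangle> + 1
        + ln (\<langle>G \<delta>, \<delta>\<rangle> / \<langle>X \<delta>, \<delta>\<rangle>)"
      using psi_bfgs_direct[OF X G m] m c X by (simp add: G'_def ln_div)
    also have "ln (\<langle>G \<delta>, \<delta>\<rangle> / \<langle>X \<delta>, \<delta>\<rangle>) \<le> \<langle>G \<delta>, \<delta>\<rangle> / \<langle>X \<delta>, \<delta>\<rangle> - 1"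
      using m c by (intro ln_le_minus_one) simp
    also have "\<langle>G \<delta>, \<delta>\<rangle> / \<langle>X \<delta>, \<delta>\<rangle> \<le> \<langle>G \<delta>, inv X (G \<delta>)\<rangle> / \<langle>G \<delta>, \<delta>\<rangle>"
      using pos_def_Cauchy_Schwarz[OF X, of "G \<delta>" \<delta>] m c
      by (simp add: field_simps power2_eq_square)
    finally show ?thesis by simp
  qed
qed

text \<open>The last term is the logarithm of the squared cosine of the angle between \<open>G \<delta>\<close> and \<open>\<delta>\<close> in
  the metric of \<open>X\<close>.\<close>

lemma psi_bfgs_direct_le:
  assumes X: "pos_def X" and G: "pos_def G" and m: "0 < \<langle>\<gamma>, \<delta>\<rangle>" and "0 < \<kappa>"
    and strong: "\<langle>X \<delta>, \<delta>\<rangle> \<le> \<kappa> * \<langle>\<gamma>, \<delta>\<rangle>" and coco: "\<langle>\<gamma>, inv X \<gamma>\<rangle> \<le> \<langle>\<gamma>, \<delta>\<rangle>"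
  shows "psi X (bfgs_direct G \<delta> \<gamma>) \<le> psi X G + ln \<kappa>
    + ln (\<langle>G \<delta>, \<delta>\<rangle>\<^sup>2 / (\<langle>G \<delta>, inv X (G \<delta>)\<rangle> * \<langle>X \<delta>, \<delta>\<rangle>))"
proof -
  have \<delta>: "\<delta> \<noteq> 0" using m by auto
  then have c: "0 < \<langle>G \<delta>, \<delta>\<rangle>" and P: "0 < \<langle>X \<delta>, \<delta>\<rangle>"
    using pos_def_pos G X by auto
  then have "G \<delta> \<noteq> 0" by auto
  then have N: "0 < \<langle>G \<delta>, inv X (G \<delta>)\<rangle>" by (rule pos_def_inv_pos[OF X])
  let ?a = "\<langle>G \<delta>, inv X (G \<delta>)\<rangle> / \<langle>G \<delta>, \<delta>\<rangle>"
  have a: "0 < ?a" using N c by simp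
  \<comment> \<open>\<open>?a\<close> is the trace lost. This replaces \<open>1 - ?a\<close>, where
    the 1 is the bound on the trace gained, by \<open>- ln ?a\<close>, which merges with the
    determinant term into the squared cosine.\<close>
  have "ln ?a \<le> ?a - 1" by (rule ln_le_minus_one[OF a])
  moreover have "\<langle>\<gamma>, inv X \<gamma>\<rangle> / \<langle>\<gamma>, \<delta>\<rangle> \<le> 1" using coco m by simp
  moreover have "ln \<langle>X \<delta>, \<delta>\<rangle> \<le> ln (\<kappa> * \<langle>\<gamma>, \<delta>\<rangle>)" using strong P by simp
  then have "ln \<langle>X \<delta>, \<delta>\<rangle> \<le> ln \<kappa> + ln \<langle>\<gamma>, \<delta>\<rangle>" using m \<open>0 < \<kappa>\<close> by (simp add: ln_mult)
  moreover have "ln ?a = ln \<langle>G \<delta>, inv X (G \<delta>)\<rangle> - ln \<langle>G \<delta>, \<delta>\<rangle>" using N c by (simp add: ln_div)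
  moreover have "ln (\<langle>\<gamma>, \<delta>\<rangle> / \<langle>G \<delta>, \<delta>\<rangle>) = ln \<langle>\<gamma>, \<delta>\<rangle> - ln \<langle>G \<delta>, \<delta>\<rangle>" using m c by (simp add: ln_div)
  moreover have "ln (\<langle>G \<delta>, \<delta>\<rangle>\<^sup>2 / (\<langle>G \<delta>, inv X (G \<delta>)\<rangle> * \<langle>X \<delta>, \<delta>\<rangle>))
      = 2 * ln \<langle>G \<delta>, \<delta>\<rangle> - ln \<langle>G \<delta>, inv X (G \<delta>)\<rangle> - ln \<langle>X \<delta>, \<delta>\<rangle>"
    using N c P by (simp add: ln_div ln_mult power2_eq_square)
  ultimately show ?thesis
    unfolding psi_bfgs_direct[OF X G m] by linarith
qed

section \<open>Smooth strongly convex functions\<close>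

text \<open>By homogeneity, the minimum of the quadratic form on the compact unit sphere serves as
  \<open>c\<close>. This links the metric to the built-in norm, in which boundedness and compactness
  are expressed.\<close>

lemma pos_def_coercive:
  fixes G :: "'a::euclidean_space \<Rightarrow> 'a dual"
  assumes "pos_def G"
  obtains c where "0 < c" "\<And>v. c * (norm v)\<^sup>2 \<le> \<langle>G v, v\<rangle>"
proof -
  have lin: "linear G" by (rule pos_def_linear[OF assms])
  have "continuous_on (sphere 0 1) (\<lambda>v. \<langle>G v, v\<rangle>)"
    by (intro continuous_intros linear_continuous_on) (simp add: lin linear_conv_bounded_linear[symmetric])
  moreover have "sphere (0::'a) 1 \<noteq> {}" by simp
  ultimately obtain w :: 'a where w: "norm w = 1" "\<And>v. norm v = 1 \<Longrightarrow> \<langle>G w, w\<rangle> \<le> \<langle>G v, v\<rangle>"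
    using continuous_attains_inf[OF compact_sphere] by (metis (no_types, lifting) mem_sphere_0)
  show thesis
  proof
    show "0 < \<langle>G w, w\<rangle>" using w(1) by (intro pos_def_pos[OF assms]) auto
    show "\<langle>G w, w\<rangle> * (norm v)\<^sup>2 \<le> \<langle>G v, v\<rangle>" for v
    proof (cases "v = 0")
      case False
      then have "\<langle>G w, w\<rangle> \<le> \<langle>G ((1 / norm v) *\<^sub>R v), (1 / norm v) *\<^sub>R v\<rangle>"
        by (intro w(2)) simp
      also have "\<dots> = \<langle>G v, v\<rangle> / (norm v)\<^sup>2"
        by (simp add: linear_scale[OF lin] blinfun.bilinear_simps power2_eq_square)
      finally show ?thesis using False by (simp add: field_simps)
    qed simp
  qed
qed

lemma taylor_upper:
  fixes f :: "'a::euclidean_space \<Rightarrow> real"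
  assumes deriv: "\<And>y. (f has_derivative blinfun_apply (g y)) (at y)"
    and bound: "\<And>t. 0 \<le> t \<Longrightarrow> t \<le> 1 \<Longrightarrow> \<langle>g (x + t *\<^sub>R v) - g x, v\<rangle> \<le> t * c"
  shows "f (x + v) \<le> f x + \<langle>g x, v\<rangle> + c / 2"
proof -
  \<comment> \<open>The error of the quadratic model along the segment, up to a constant;
    \<open>bound\<close> makes its derivative nonpositive.\<close>
  define \<phi> where "\<phi> t = f (x + t *\<^sub>R v) - t * \<langle>g x, v\<rangle> - c * t\<^sup>2 / 2" for t
  have "\<phi> 1 \<le> \<phi> 0"
  proof (rule DERIV_nonpos_imp_nonincreasing[where f = \<phi>])
    fix t :: real
    assume t: "0 \<le> t" "t \<le> 1"
    have "((\<lambda>t. f (x + t *\<^sub>R v)) has_derivative (\<lambda>s. \<langle>g (x + t *\<^sub>R v), s *\<^sub>R v\<rangle>)) (at t)"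
      by (rule has_derivative_compose[where g = f, OF _ deriv]) (auto intro!: derivative_eq_intros)
    then have D: "((\<lambda>t. f (x + t *\<^sub>R v)) has_real_derivative \<langle>g (x + t *\<^sub>R v), v\<rangle>) (at t)"
      by (simp add: has_field_derivative_def blinfun.scaleR_right mult.commute mult_commute_abs)
    have "(\<phi> has_real_derivative (\<langle>g (x + t *\<^sub>R v), v\<rangle> - \<langle>g x, v\<rangle> - c * t)) (at t)"
      unfolding \<phi>_def by (auto intro!: derivative_eq_intros D)
    moreover have "\<langle>g (x + t *\<^sub>R v), v\<rangle> - \<langle>g x, v\<rangle> - c * t \<le> 0"
      using bound[OF t] by (simp add: blinfun.bilinear_simps mult.commute)
    ultimately show "\<exists>y. (\<phi> has_real_derivative y) (at t) \<and> y \<le> 0" by blast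
  qed simp
  then show ?thesis by (simp add: \<phi>_def)
qed

text \<open>The upper bound for the negatives of \<open>f\<close>, \<open>g\<close> and
  \<open>c\<close>.\<close>

lemma taylor_lower:
  fixes f :: "'a::euclidean_space \<Rightarrow> real"
  assumes deriv: "\<And>y. (f has_derivative blinfun_apply (g y)) (at y)"
    and bound: "\<And>t. 0 \<le> t \<Longrightarrow> t \<le> 1 \<Longrightarrow> t * c \<le> \<langle>g (x + t *\<^sub>R v) - g x, v\<rangle>"
  shows "f x + \<langle>g x, v\<rangle> + c / 2 \<le> f (x + v)"
proof -
  have "((\<lambda>y. - f y) has_derivative blinfun_apply (- g y)) (at y)" for y
    using has_derivative_minus[OF deriv[of y]] by (simp add: blinfun.minus_left[abs_def])
  then have "- f (x + v) \<le> - f x + \<langle>- g x, v\<rangle> + (- c) / 2"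
    by (rule taylor_upper) (use bound in \<open>force simp: blinfun.bilinear_simps\<close>)
  then show ?thesis by (simp add: blinfun.bilinear_simps)
qed

text \<open>The metric is normalised by \<open>X = L B\<close>, so that the gradient is 1-Lipschitz and the
  constant of strong convexity is \<open>1 / \<kappa>\<close>.\<close>

locale smooth_strongly_convex =
  fixes X :: "'a::euclidean_space \<Rightarrow> 'a dual"
    and f :: "'a \<Rightarrow> real"
    and g :: "'a \<Rightarrow> 'a dual"
    and \<kappa> :: real
  assumes X: "pos_def X"
    and \<kappa>: "0 < \<kappa>"
    and deriv: "\<And>y. (f has_derivative blinfun_apply (g y)) (at y)"
    and strong: "\<And>y z. \<langle>X (y - z), y - z\<rangle> \<le> \<kappa> * \<langle>g y - g z, y - z\<rangle>"
    and smooth: "\<And>y z. \<langle>g y - g z, inv X (g y - g z)\<rangle> \<le> \<langle>X (y - z), y - z\<rangle>"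
begin

lemma quadratic_scale: "\<langle>X (t *\<^sub>R v), t *\<^sub>R v\<rangle> = t\<^sup>2 * \<langle>X v, v\<rangle>"
  by (simp add: linear_scale[OF pos_def_linear[OF X]] blinfun.bilinear_simps power2_eq_square)

text \<open>Cauchy-Schwarz turns the Lipschitz bound on the gradient into the directional bound that
  \<open>taylor_upper\<close> asks for.\<close>

lemma quadratic_upper: "f (x + v) \<le> f x + \<langle>g x, v\<rangle> + \<langle>X v, v\<rangle> / 2"
proof (rule taylor_upper[OF deriv])
  fix t :: real
  assume t: "0 \<le> t"
  define s where "s = g (x + t *\<^sub>R v) - g x"
  have P: "0 \<le> \<langle>X v, v\<rangle>" by (rule pos_def_nonneg[OF X])
  have "\<langle>s, v\<rangle>\<^sup>2 \<le> \<langle>s, inv X s\<rangle> * \<langle>X v, v\<rangle>" by (rule pos_def_Cauchy_Schwarz[OF X])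
  also have "\<dots> \<le> (t\<^sup>2 * \<langle>X v, v\<rangle>) * \<langle>X v, v\<rangle>"
    using smooth[of "x + t *\<^sub>R v" x] P
    by (intro mult_right_mono) (simp_all add: s_def quadratic_scale)
  also have "\<dots> = (t * \<langle>X v, v\<rangle>)\<^sup>2" by (simp add: power2_eq_square)
  finally have "\<langle>s, v\<rangle> \<le> t * \<langle>X v, v\<rangle>"
    by (rule power2_le_imp_le) (simp add: t P)
  then show "\<langle>g (x + t *\<^sub>R v) - g x, v\<rangle> \<le> t * \<langle>X v, v\<rangle>"
    by (simp only: s_def)
qed

lemma quadratic_lower: "f x + \<langle>g x, v\<rangle> + \<langle>X v, v\<rangle> / \<kappa> / 2 \<le> f (x + v)"
proof (rule taylor_lower[OF deriv])
  fix t :: real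
  assume "0 \<le> t"
  show "t * (\<langle>X v, v\<rangle> / \<kappa>) \<le> \<langle>g (x + t *\<^sub>R v) - g x, v\<rangle>"
  proof (cases "t = 0")
    case False
    then have t: "0 < t" using \<open>0 \<le> t\<close> by simp
    have "t\<^sup>2 * \<langle>X v, v\<rangle> \<le> \<kappa> * (t * \<langle>g (x + t *\<^sub>R v) - g x, v\<rangle>)"
      using strong[of "x + t *\<^sub>R v" x] quadratic_scale[of t v]
      by (simp add: blinfun.scaleR_right)
    then have "t * (t * \<langle>X v, v\<rangle>) \<le> t * (\<kappa> * \<langle>g (x + t *\<^sub>R v) - g x, v\<rangle>)"
      by (simp add: power2_eq_square mult_ac)
    then have "t * \<langle>X v, v\<rangle> \<le> \<kappa> * \<langle>g (x + t *\<^sub>R v) - g x, v\<rangle>"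
      using t by (simp only: mult_le_cancel_left_pos)
    then show ?thesis using \<kappa> by (simp add: field_simps)
  qed simp
qed

text \<open>Subtracting the functional \<open>g x\<close> from \<open>f\<close> gives a function
  minimal at \<open>x\<close>. Its value there is at most its value after one gradient step
  \<open>w\<close> from \<open>y\<close> in the metric \<open>X\<close>, and
  \<open>quadratic_upper\<close> bounds that value from above.\<close>

lemma gradient_gap: "f x + \<langle>g x, y - x\<rangle> + \<langle>g y - g x, inv X (g y - g x)\<rangle> / 2 \<le> f y"
proof -
  define s w where "s = g y - g x" and "w = inv X s"
  have "X w = s" using X by (simp add: w_def)
  then have "f (y + - w) \<le> f y - \<langle>g y, w\<rangle> + \<langle>s, w\<rangle> / 2"
    using quadratic_upper[of y "- w"] quadratic_scale[of "-1" w] by (simp add: blinfun.minus_right)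
  moreover have "f x + \<langle>g x, y - w - x\<rangle> \<le> f (x + (y - w - x))"
    using quadratic_lower[of x "y - w - x"] pos_def_nonneg[OF X, of "y - w - x"] \<kappa>
    by (smt (verit) divide_nonneg_pos)
  moreover have "\<langle>g y, w\<rangle> = \<langle>s, w\<rangle> + \<langle>g x, w\<rangle>" by (simp add: s_def blinfun.diff_left)
  ultimately have "f x + \<langle>g x, y - x\<rangle> + \<langle>s, w\<rangle> / 2 \<le> f y"
    by (simp add: blinfun.diff_right)
  then show ?thesis by (simp only: s_def w_def)
qed

text \<open>Add \<open>gradient_gap\<close> to itself with \<open>x\<close> and \<open>y\<close>
  exchanged; the values of \<open>f\<close> cancel.\<close>

lemma cocoercive: "\<langle>g y - g x, inv X (g y - g x)\<rangle> \<le> \<langle>g y - g x, y - x\<rangle>"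
proof -
  have "\<langle>g x - g y, inv X (g x - g y)\<rangle> = \<langle>g y - g x, inv X (g y - g x)\<rangle>"
    using linear_neg[OF pos_def_linear_inv[OF X], of "g y - g x"]
    by (simp add: blinfun.bilinear_simps)
  moreover have "\<langle>g y, x - y\<rangle> = - \<langle>g y, y - x\<rangle>"
    by (simp add: blinfun.diff_right)
  ultimately show ?thesis
    using gradient_gap[of x y] gradient_gap[of y x] blinfun.diff_left[of "g y" "g x" "y - x"]
    by linarith
qed

text \<open>The strongly convex lower bound at 0 makes the sublevel set of \<open>f 0\<close>
  bounded, hence compact.\<close>

lemma minimizer_exists: "\<exists>z. \<forall>y. f z \<le> f y"
proof -
  obtain c where c: "0 < c" "\<And>v. c * (norm v)\<^sup>2 \<le> \<langle>X v, v\<rangle>"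
    using pos_def_coercive[OF X] by blast
  let ?S = "{y. f y \<le> f 0}"
  have cont: "continuous_on UNIV f"
    by (intro continuous_at_imp_continuous_on ballI has_derivative_continuous[OF deriv])
  have "norm y \<le> 2 * \<kappa> * norm (g 0) / c" if "f y \<le> f 0" for y
  proof (cases "y = 0")
    case False
    have "\<langle>X y, y\<rangle> / \<kappa> / 2 \<le> - \<langle>g 0, y\<rangle>"
      using quadratic_lower[of 0 y] that by simp
    also have "\<dots> \<le> norm (g 0) * norm y"
      using norm_blinfun[of "g 0" y] by simp
    finally have "\<langle>X y, y\<rangle> \<le> 2 * \<kappa> * norm (g 0) * norm y"
      using \<kappa> by (simp add: field_simps)
    then have "(c * norm y) * norm y \<le> (2 * \<kappa> * norm (g 0)) * norm y"
      using c(2)[of y] by (simp add: power2_eq_square)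
    then have "c * norm y \<le> 2 * \<kappa> * norm (g 0)"
      using False by simp
    then show ?thesis using c(1) by (simp add: field_simps)
  qed (use c \<kappa> in simp)
  then have "bounded ?S" by (auto intro!: boundedI)
  moreover have "closed ?S"
    using cont by (intro closed_Collect_le) auto
  ultimately have "compact ?S" by (simp add: compact_eq_bounded_closed)
  then obtain z where "z \<in> ?S" "\<forall>y\<in>?S. f z \<le> f y"
    using continuous_attains_inf[of ?S f] cont continuous_on_subset by blast
  then show ?thesis by (metis linear mem_Collect_eq order_trans)
qed

text \<open>The Polyak-Lojasiewicz inequality. Young's inequality with weight \<kappa> absorbs the
  linear term of \<open>quadratic_lower\<close> exactly into its quadratic term.\<close>

lemma gap_le_gradient: "f x - f z \<le> \<kappa> / 2 * \<langle>g x, inv X (g x)\<rangle>"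
proof -
  have "- \<langle>g x, z - x\<rangle> * 2 \<le> \<kappa> * \<langle>g x, inv X (g x)\<rangle> + \<langle>X (z - x), z - x\<rangle> / \<kappa>"
    using pos_def_discriminant[OF X \<kappa>, of "- g x" "z - x"]
      linear_neg[OF pos_def_linear_inv[OF X], of "g x"]
    by (simp add: blinfun.bilinear_simps)
  then show ?thesis using quadratic_lower[of x "z - x"] by simp
qed

end

section \<open>Convergence\<close>

lemma prod_one_minus_le:
  fixes c :: "nat \<Rightarrow> real"
  assumes "\<And>i. i < k \<Longrightarrow> c i \<le> 1" "real k * q \<le> (\<Sum>i<k. c i)"
  shows "(\<Prod>i<k. 1 - c i) \<le> (1 - q) ^ k"
proof (cases "k = 0")
  case False
  define p where "p = (\<Prod>i<k. 1 - c i)"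
  have p: "0 \<le> p" unfolding p_def using assms(1) by (intro prod_nonneg) auto
  have "p powr (1 / k) \<le> (\<Sum>i<k. (1 - c i) / k)"
    using arith_geom_mean[of "{..<k}" "\<lambda>i. 1 - c i"] assms(1) False
    by (simp add: p_def lessThan_empty_iff)
  also have "\<dots> = (k - (\<Sum>i<k. c i)) / k"
    by (simp add: sum_divide_distrib[symmetric] sum_subtractf)
  also have "\<dots> \<le> 1 - q"
    using assms(2) False by (simp add: field_simps)
  finally have "(p powr (1 / k)) ^ k \<le> (1 - q) ^ k"
    by (rule power_mono) simp
  \<comment> \<open>For \<open>p = 0\<close> this uses that \<open>powr\<close> is 0 at base 0 and
    that \<open>k\<close> is nonzero.\<close>
  moreover have "(p powr (1 / k)) ^ k = p"
    using p False by (cases "p = 0") (simp_all add: powr_power)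
  ultimately show ?thesis by (simp add: p_def)
qed simp

lemma contraction_product:
  fixes a c :: "nat \<Rightarrow> real"
  assumes "\<And>i. c i \<le> 1" "\<And>i. a (Suc i) \<le> (1 - c i) * a i"
  shows "a k \<le> (\<Prod>i<k. 1 - c i) * a 0"
proof (induction k)
  case (Suc k)
  have "a (Suc k) \<le> (1 - c k) * a k" by (rule assms(2))
  also have "\<dots> \<le> (1 - c k) * ((\<Prod>i<k. 1 - c i) * a 0)"
    using assms(1)[of k] Suc by (intro mult_left_mono) auto
  finally show ?case by (simp add: mult_ac)
qed simp

text \<open>Apply \<open>ln t \<le> t - 1\<close> to \<open>2 * \<kappa> * c i\<close> and sum. The
  factor 2 contributes \<open>k * ln 2\<close>, at least \<open>k / 2\<close>, which pays for
  \<open>p\<close>; this is where the threshold of twice the initial potential comes from.\<close>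

lemma sum_ge_of_sum_ln_ge:
  fixes c :: "nat \<Rightarrow> real"
  assumes "0 < \<kappa>" "\<And>i. 0 < c i" "2 * p \<le> real k" "- p - real k * ln \<kappa> \<le> (\<Sum>i<k. ln (c i))"
  shows "real k / (2 * \<kappa>) \<le> (\<Sum>i<k. c i)"
proof -
  have "ln (1 / 2 :: real) \<le> - 1 / 2"
    using ln_le_minus_one[of "1 / 2 :: real"] by simp
  then have ln2: "1 / 2 \<le> ln (2 :: real)" by (simp add: ln_div)
  have "ln 2 + ln \<kappa> + ln (c i) \<le> 2 * \<kappa> * c i - 1" for i
    using ln_le_minus_one[of "2 * \<kappa> * c i"] assms(1) assms(2)[of i] by (simp add: ln_mult)
  then have "(\<Sum>i<k. ln 2 + ln \<kappa> + ln (c i)) \<le> (\<Sum>i<k. 2 * \<kappa> * c i - 1)"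
    by (rule sum_mono)
  then have "k * ln 2 + k * ln \<kappa> + (\<Sum>i<k. ln (c i)) \<le> 2 * \<kappa> * (\<Sum>i<k. c i) - k"
    by (simp add: sum.distrib sum_subtractf sum_distrib_left distrib_left)
  moreover have "real k * (1 / 2) \<le> real k * ln 2"
    by (rule mult_left_mono[OF ln2]) simp
  ultimately have "real k \<le> 2 * \<kappa> * (\<Sum>i<k. c i)"
    using assms(3,4) by simp
  then show ?thesis using assms(1) by (simp add: field_simps)
qed

locale bfgs_run = smooth_strongly_convex X f g \<kappa>
  for X :: "'a::euclidean_space \<Rightarrow> 'a dual" and f g \<kappa> +
  fixes x d :: "nat \<Rightarrow> 'a" and H :: "nat \<Rightarrow> 'a dual \<Rightarrow> 'a" and h :: "nat \<Rightarrow> real"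
  assumes H0: "pos_def_dual (H 0)"
    and run: "bfgs_method g x H d h"
begin

lemma direction: "d i = H i (g (x i))"
  and step_pos: "0 < h i"
  and step: "x (Suc i) - x i = - h i *\<^sub>R d i"
  and update: "H (Suc i) = bfgs_update (H i) (x (Suc i) - x i) (g (x (Suc i)) - g (x i))"
  and curvature: "0 < \<langle>g (x (Suc i)) - g (x i), x (Suc i) - x i\<rangle>"
proof -
  note all = run[unfolded bfgs_method_def Let_def, rule_format, of i]
  show "d i = H i (g (x i))" "0 < h i"
    "H (Suc i) = bfgs_update (H i) (x (Suc i) - x i) (g (x (Suc i)) - g (x i))"
    "0 < \<langle>g (x (Suc i)) - g (x i), x (Suc i) - x i\<rangle>"
    using all by blast+
  have "x (Suc i) = x i - h i *\<^sub>R d i" using all by blast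
  then show "x (Suc i) - x i = - h i *\<^sub>R d i" by simp
qed

lemma pos_def_dual_H: "pos_def_dual (H i)"
  by (induction i) (simp_all add: H0 update bfgs_update_direct(1)[OF _ curvature])

lemma inv_H_direction: "inv (H i) (d i) = g (x i)"
  using pos_def_dual_bij[OF pos_def_dual_H[of i]] by (simp add: direction bij_is_inj)

lemma direction_nonzero: "d i \<noteq> 0"
  using curvature[of i] step[of i] by auto

lemma gradient_nonzero: "g (x i) \<noteq> 0"
  using direction_nonzero[of i] pos_def_dual_H[of i]
  by (auto simp: direction pos_def_dual_def linear_0)

text \<open>The squared cosine, in the metric \<open>X\<close>, of the angle between
  \<open>d i\<close> and the gradient vector \<open>inv X (g (x i))\<close>.\<close>

definition cos2 :: "nat \<Rightarrow> real" where
  "cos2 i = \<langle>g (x i), d i\<rangle>\<^sup>2 / (\<langle>g (x i), inv X (g (x i))\<rangle> * \<langle>X (d i), d i\<rangle>)"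

lemma cos2_pos: "0 < cos2 i"
proof -
  have "0 < \<langle>g (x i), d i\<rangle>"
    using pos_def_dual_H[of i] gradient_nonzero[of i] by (simp add: direction pos_def_dual_def)
  then show ?thesis
    using pos_def_inv_pos[OF X gradient_nonzero] pos_def_pos[OF X direction_nonzero]
    by (simp add: cos2_def)
qed

lemma psi_step: "psi X (inv (H (Suc i))) \<le> psi X (inv (H i)) + ln \<kappa> + ln (cos2 i)"
proof -
  define \<delta> \<gamma> G where "\<delta> = x (Suc i) - x i" and "\<gamma> = g (x (Suc i)) - g (x i)" and "G = inv (H i)"
  have m: "0 < \<langle>\<gamma>, \<delta>\<rangle>" using curvature by (simp add: \<gamma>_def \<delta>_def)
  have pG: "pos_def G" unfolding G_def by (rule pos_def_inv_dual[OF pos_def_dual_H])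
  have "inv (H (Suc i)) = bfgs_direct G \<delta> \<gamma>"
    unfolding update G_def \<delta>_def \<gamma>_def by (rule bfgs_update_direct(2)[OF pos_def_dual_H curvature])
  moreover have "psi X (bfgs_direct G \<delta> \<gamma>) \<le> psi X G + ln \<kappa>
    + ln (\<langle>G \<delta>, \<delta>\<rangle>\<^sup>2 / (\<langle>G \<delta>, inv X (G \<delta>)\<rangle> * \<langle>X \<delta>, \<delta>\<rangle>))"
    by (rule psi_bfgs_direct_le[OF X pG m \<kappa>]) (simp_all add: \<gamma>_def \<delta>_def strong cocoercive)
  \<comment> \<open>Since \<open>G\<close> sends \<open>d i\<close> to the gradient, \<delta> and
    \<open>G \<delta>\<close> are the direction and the gradient times \<open>- h i\<close>; the
    quotient does not change under this scaling.\<close>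
  moreover have "\<langle>G \<delta>, \<delta>\<rangle>\<^sup>2 / (\<langle>G \<delta>, inv X (G \<delta>)\<rangle> * \<langle>X \<delta>, \<delta>\<rangle>) = cos2 i"
  proof -
    have G\<delta>: "G \<delta> = - h i *\<^sub>R g (x i)"
      using linear_scale[OF pos_def_linear[OF pG], of "- h i" "d i"]
      by (simp add: \<delta>_def step G_def inv_H_direction)
    have \<delta>: "\<delta> = - h i *\<^sub>R d i" by (simp add: \<delta>_def step)
    show ?thesis
      unfolding G\<delta> unfolding \<delta> cos2_def quadratic_scale linear_scale[OF pos_def_linear_inv[OF X]]
      using step_pos[of i]
      by (simp add: blinfun.bilinear_simps power2_eq_square)
  qed
  ultimately show ?thesis by (simp add: G_def)
qed

text \<open>Sum \<open>psi_step\<close> over the first \<open>k\<close> updates and drop the final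
  potential, which is nonnegative.\<close>

lemma sum_ln_cos2: "- psi X (inv (H 0)) - real k * ln \<kappa> \<le> (\<Sum>i<k. ln (cos2 i))"
proof -
  have "psi X (inv (H k)) \<le> psi X (inv (H 0)) + real k * ln \<kappa> + (\<Sum>i<k. ln (cos2 i))" for k
  proof (induction k)
    case (Suc k)
    then show ?case using psi_step[of k] by (simp add: algebra_simps)
  qed simp
  moreover have "0 \<le> psi X (inv (H k))"
    by (rule psi_nonneg[OF X pos_def_inv_dual[OF pos_def_dual_H]])
  ultimately show ?thesis by (smt (verit))
qed

lemma linear_rate:
  assumes min: "\<And>y. f z \<le> f y" and \<eta>: "0 < \<eta>"
    and decrease: "\<And>i. \<eta> * (\<langle>g (x i), d i\<rangle>\<^sup>2 / \<langle>X (d i), d i\<rangle>) \<le> f (x i) - f (x (Suc i))"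
    and k: "2 * psi X (inv (H 0)) \<le> real k"
  shows "f (x k) - f z \<le> (1 - \<eta> / \<kappa>\<^sup>2) ^ k * (f (x 0) - f z)"
proof -
  \<comment> \<open>The decrease is at least \<eta> times \<open>cos2 i\<close> times the squared
    dual norm of the gradient, and by \<open>gap_le_gradient\<close> that squared norm is at least
    \<open>2 / \<kappa>\<close> times the gap.\<close>
  define c where "c i = 2 * \<eta> / \<kappa> * cos2 i" for i
  have gap: "c i * (f (x i) - f z) \<le> f (x i) - f (x (Suc i))" for i
  proof -
    have N: "0 < \<langle>g (x i), inv X (g (x i))\<rangle>" by (rule pos_def_inv_pos[OF X gradient_nonzero])
    have "c i * (f (x i) - f z) \<le> c i * (\<kappa> / 2 * \<langle>g (x i), inv X (g (x i))\<rangle>)"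
      using cos2_pos[of i] \<eta> \<kappa> by (intro mult_left_mono gap_le_gradient) (simp add: c_def)
    also have "\<dots> = \<eta> * (\<langle>g (x i), d i\<rangle>\<^sup>2 / \<langle>X (d i), d i\<rangle>)"
      using N \<kappa> by (simp add: c_def cos2_def)
    finally show ?thesis using decrease[of i] by simp
  qed
  \<comment> \<open>One step cannot remove more than the whole gap. Strict decrease makes the gap
    positive, so it can be cancelled.\<close>
  have c1: "c i \<le> 1" for i
  proof -
    have "\<langle>g (x i), d i\<rangle> \<noteq> 0" using cos2_pos[of i] by (auto simp: cos2_def)
    then have "0 < \<langle>g (x i), d i\<rangle>\<^sup>2 / \<langle>X (d i), d i\<rangle>"
      using pos_def_pos[OF X direction_nonzero[of i]] by simp
    then have "f (x (Suc i)) < f (x i)"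
      using decrease[of i] \<eta> by (smt (verit) mult_pos_pos)
    then have "0 < f (x i) - f z" using min[of "x (Suc i)"] by simp
    moreover have "c i * (f (x i) - f z) \<le> 1 * (f (x i) - f z)"
      using gap[of i] min[of "x (Suc i)"] by simp
    ultimately show ?thesis by (simp only: mult_le_cancel_right_pos)
  qed
  have "f (x k) - f z \<le> (\<Prod>i<k. 1 - c i) * (f (x 0) - f z)"
    by (rule contraction_product[OF c1]) (use gap in \<open>simp add: algebra_simps\<close>)
  also have "\<dots> \<le> (1 - \<eta> / \<kappa>\<^sup>2) ^ k * (f (x 0) - f z)"
  proof (intro mult_right_mono prod_one_minus_le)
    \<comment> \<open>The mean of the \<open>c i\<close> is thus at least
      \<open>2 * \<eta> / \<kappa>\<close> times \<open>1 / (2 * \<kappa>)\<close>, which is the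
      rate in the claim.\<close>
    have "real k / (2 * \<kappa>) \<le> (\<Sum>i<k. cos2 i)"
      by (rule sum_ge_of_sum_ln_ge[OF \<kappa> cos2_pos k sum_ln_cos2])
    then have "2 * \<eta> / \<kappa> * (real k / (2 * \<kappa>)) \<le> 2 * \<eta> / \<kappa> * (\<Sum>i<k. cos2 i)"
      using \<eta> \<kappa> by (intro mult_left_mono) auto
    then show "real k * (\<eta> / \<kappa>\<^sup>2) \<le> (\<Sum>i<k. c i)"
      by (simp add: c_def sum_distrib_left power2_eq_square mult_ac)
  qed (use c1 min in auto)
  finally show ?thesis .
qed

end

theorem corollary4p10:
  fixes B :: "'a::euclidean_space \<Rightarrow> 'a dual"
    and f :: "'a \<Rightarrow> real"
    and gradf :: "'a \<Rightarrow> 'a dual"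
    and \<mu> L \<eta> :: real
    and x d :: "nat \<Rightarrow> 'a"
    and H :: "nat \<Rightarrow> 'a dual \<Rightarrow> 'a"
    and h :: "nat \<Rightarrow> real"
    and k :: nat
  assumes "pos_def B"
    and "\<And>y. (f has_derivative blinfun_apply (gradf y)) (at y)"
    and "\<mu> > 0" and "L > 0"
    and "\<And>y z. \<langle>gradf y - gradf z, y - z\<rangle> \<ge> \<mu> * (primal_norm B (y - z))\<^sup>2"
    and "\<And>y z. dual_norm B (gradf y - gradf z) \<le> L * primal_norm B (y - z)"
    and "pos_def_dual (H 0)"
    and "bfgs_method gradf x H d h"
    and "\<eta> > 0"
    and "\<And>i. f (x i) - f (x (Suc i))
              \<ge> \<eta> * (\<langle>gradf (x i), d i\<rangle>\<^sup>2 / (L * (primal_norm B (d i))\<^sup>2))"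
    and "int k \<ge> \<lceil>2 * psi (\<lambda>u. L *\<^sub>R B u) (inv (H 0))\<rceil>"
  shows "f (x k) - (LEAST m. m \<in> range f)
           \<le> (1 - \<eta> * (L / \<mu>) powi (-2)) ^ k * (f (x 0) - (LEAST m. m \<in> range f))"
proof -
  define X where "X = (\<lambda>u. L *\<^sub>R B u)"
  have X: "pos_def X" unfolding X_def by (rule pos_def_scaleR[OF assms(1,4)])
  have primal: "(primal_norm B u)\<^sup>2 = \<langle>B u, u\<rangle>" for u
    by (simp add: primal_norm_def pos_def_nonneg[OF assms(1)])
  have XB: "\<langle>X u, u\<rangle> = L * (primal_norm B u)\<^sup>2" for u
    by (simp add: X_def primal blinfun.scaleR_left)
  have "X ((1 / L) *\<^sub>R inv B s) = s" for s
    using assms(1,4) by (simp add: X_def linear_scale[OF pos_def_linear[OF assms(1)]])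
  then have "inv X s = (1 / L) *\<^sub>R inv B s" for s
    using pos_def_inv_simps(1)[OF X] by metis
  then have dual: "\<langle>s, inv X s\<rangle> = (dual_norm B s)\<^sup>2 / L" for s
    by (simp add: dual_norm_def pos_def_inv_nonneg[OF assms(1)] blinfun.scaleR_right)
  interpret bfgs_run X f gradf "L / \<mu>" x d H h
  proof
    show "\<langle>X (y - z), y - z\<rangle> \<le> L / \<mu> * \<langle>gradf y - gradf z, y - z\<rangle>" for y z
      using mult_left_mono[OF assms(5)[where y = y and z = z], of "L / \<mu>"] assms(3,4)
      by (simp add: XB)
    show "\<langle>gradf y - gradf z, inv X (gradf y - gradf z)\<rangle> \<le> \<langle>X (y - z), y - z\<rangle>" for y z
    proof -
      have "0 \<le> dual_norm B (gradf y - gradf z)"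
        by (simp add: dual_norm_def pos_def_inv_nonneg[OF assms(1)])
      then have "(dual_norm B (gradf y - gradf z))\<^sup>2 \<le> (L * primal_norm B (y - z))\<^sup>2"
        by (intro power_mono assms(6))
      then show ?thesis
        using assms(4) by (simp add: dual XB field_simps power2_eq_square)
    qed
  qed (use X assms in simp_all)
  obtain z where z: "\<And>y. f z \<le> f y" using minimizer_exists by blast
  \<comment> \<open>On the reals \<open>LEAST\<close> gives the minimum only because it is attained,
    here at \<open>z\<close>.\<close>
  have least: "(LEAST m. m \<in> range f) = f z"
    by (rule Least_equality) (use z in auto)
  have "2 * psi X (inv (H 0)) \<le> real k"
    using assms(11) by (simp add: ceiling_le_iff X_def)
  then have "f (x k) - f z \<le> (1 - \<eta> / (L / \<mu>)\<^sup>2) ^ k * (f (x 0) - f z)"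
    using z assms(9,10) by (intro linear_rate) (simp_all add: XB)
  then show ?thesis
    by (simp add: least power_int_minus divide_inverse)
qed

end
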